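(* Every strict morphism of groupoid crossed modules $\chi:\mathfrak G_1\to\mathfrak G_2$ induces a crossing (from $\mathfrak G_1$ to $\mathfrak G_2$).
   Context: **Groupoids and crossed modules.** In a topological groupoid $\mathcal G\rightrightarrows\mathcal G^0$ an arrow $g:x\to y$ has source $s(g)=x$ and target $t(g)=y$; the product $gf$ is defined when $s(g)=t(f)$; units are identified with identity arrows. A strict morphism of topological groupoids is a continuous functor. A bundle of topological groups over $X$ is a topological groupoid $\mathcal H\rightrightarrows X$ with $s=t$; its fibre at $x$ is denoted $\mathcal H^x$. An action by automorphisms of $\mathcal G\rightrightarrows X$ on $\mathcal H\to X$ assigns to each arrow $g:x\to y$ of $\mathcal G$ an isomorphism of topological groups $\mathcal H^y\to\mathcal H^x$, $h\mapsto h^g$, continuously in $(h,g)$, with $h^{gf}=(h^g)^f$ and $h^{1_x}=h$. A groupoid crossed module $\mathfrak G=(\mathcal H\xrightarrow{\partial}\mathcal G)$ with unit space $X$ consists of a topological groupoid $\mathcal G\rightrightarrows X$, a bundle of topological groups $\mathcal H\to X$, a strict morphism $\partial:\mathcal H\to\mathcal G$ that is the identity on $X$, and an action by automorphisms of $\mathcal G$ on $\mathcal H$ such that $\partial(h^g)=g^{-1}\partial(h)g$ for $h\in\mathcal H^{t(g)}$, and $k^{\partial(h)}=h^{-1}kh$ for $h,k$ in the same fibre. **Strict morphisms.** Let $\mathfrak G_i=(\mathcal H_i\xrightarrow{\partial_i}\mathcal G_i)$, $i=1,2$, be groupoid crossed modules. A strict morphism $\chi:\mathfrak G_1\to\mathfrak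 G_2$ is a pair of strict groupoid morphisms $\mathcal H_1\to\mathcal H_2$ and $\mathcal G_1\to\mathcal G_2$ (both written $\chi$) such that $\chi\circ\partial_1=\partial_2\circ\chi$ and $\chi(h^g)=\chi(h)^{\chi(g)}$ for every arrow $g$ of $\mathcal G_1$ and $h\in\mathcal H_1^{t(g)}$. The unit spaces of $\mathfrak G_1$ and $\mathfrak G_2$ need not coincide. **Pullbacks.** Let $\mathfrak G=(\mathcal H\xrightarrow{\partial}\mathcal G)$ be a groupoid crossed module and $\sigma:Z\to\mathcal G^0$ a continuous map. The pullback groupoid $\mathcal G[Z]=\{(z_1,g,z_2)\in Z\times\mathcal G\times Z:\sigma(z_1)=t(g),\ s(g)=\sigma(z_2)\}$ is a topological groupoid over $Z$ with target $z_1$, source $z_2$ and product $(z_1,g,z_2)(z_2,f,z_3)=(z_1,gf,z_3)$. Put $\mathcal H[Z]=\{(z,h)\in Z\times\mathcal H: h\in\mathcal H^{\sigma(z)}\}$, a bundle of topological groups over $Z$. The pullback crossed module is $\sigma^*\partial:\mathcal H[Z]\to\mathcal G[Z]$, $(z,h)\mapsto(z,\partial(h),z)$, with action $(z_1,h)^{(z_1,g,z_2)}=(z_2,h^g)$. **Crossings.** Let $\mathfrak G_i=(\mathcal H_i\xrightarrow{\partial_i}\mathcal G_i)$, $i=1,2$, have unit spaces $X_i$. A crossing from $\mathfrak G_1$ to $\mathfrak G_2$ is a quintuple $(\mathcal M,\alpha_1,\alpha_2,\beta_1,\beta_2)$, where $\mathcal M\rightrightarrows\mathcal M^0$ is a topological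 groupoid together with continuous maps $X_1\xleftarrow{\tau}\mathcal M^0\xrightarrow{\sigma}X_2$, and $\alpha_1:\mathcal H_1[\mathcal M^0]\to\mathcal M$, $\alpha_2:\mathcal M\to\mathcal G_1[\mathcal M^0]$, $\beta_1:\mathcal H_2[\mathcal M^0]\to\mathcal M$, $\beta_2:\mathcal M\to\mathcal G_2[\mathcal M^0]$ are strict groupoid morphisms (pullbacks being along $\tau$ for index 1 and along $\sigma$ for index 2) with $\alpha_2\alpha_1=\tau^*\partial_1$ and $\beta_2\beta_1=\sigma^*\partial_2$, such that: (1) $\alpha_i,\beta_i$, $i=1,2$, are the identity on the unit space $\mathcal M^0$; (2) the diagonals $\mathcal H_1[\mathcal M^0]\xrightarrow{\alpha_1}\mathcal M\xrightarrow{\beta_2}\mathcal G_2[\mathcal M^0]$ and $\mathcal H_2[\mathcal M^0]\xrightarrow{\beta_1}\mathcal M\xrightarrow{\alpha_2}\mathcal G_1[\mathcal M^0]$ are complexes, i.e. $\beta_2\alpha_1$ and $\alpha_2\beta_1$ take values in units; (3) $\mathcal H_2[\mathcal M^0]\xrightarrow{\beta_1}\mathcal M\xrightarrow{\alpha_2}\mathcal G_1[\mathcal M^0]$ is an extension of topological groupoids over $\mathcal M^0$ ($\beta_1$ is a homeomorphism onto its image, $\alpha_2$ is surjective, and the image of $\beta_1$ is the kernel of $\alpha_2$); (4) $\alpha_1(h_1^{\alpha_2(m)})=m^{-1}\alpha_1(h_1)m$ and $\beta_1(h_2^{\beta_2(m)})=m^{-1}\beta_1(h_2)m$ for all $m\in\mathcal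 M$ and all $h_1\in\mathcal H_1[\mathcal M^0]$, $h_2\in\mathcal H_2[\mathcal M^0]$ in the fibres over $t(m)$. *)

theory Defs
  imports "HOL-Analysis.Analysis"
begin

section \<open>Topological groupoids\<close>

text \<open>
  Spaces are abstract topologies, with carrier \<open>topspace\<close>. Objects and arrows live in
  separate types; the embedding \<open>gunit\<close> of the unit space into the space of arrows
  replaces the identification of units with identity arrows. The product \<open>gcomp G g f\<close>
  (first \<open>f\<close>, then \<open>g\<close>) is meaningful only if \<open>src G g = tgt G f\<close>.
\<close>

record ('x, 'a) groupoid =
  objs :: "'x topology"
  arrs :: "'a topology"
  src :: "'a \<Rightarrow> 'x"
  tgt :: "'a \<Rightarrow> 'x"
  gunit :: "'x \<Rightarrow> 'a"
  gcomp :: "'a \<Rightarrow> 'a \<Rightarrow> 'a"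
  ginv :: "'a \<Rightarrow> 'a"

abbreviation Arr :: "('x, 'a) groupoid \<Rightarrow> 'a set" where
  "Arr G \<equiv> topspace (arrs G)"

abbreviation Obj :: "('x, 'a) groupoid \<Rightarrow> 'x set" where
  "Obj G \<equiv> topspace (objs G)"

definition composable :: "('x, 'a) groupoid \<Rightarrow> ('a \<times> 'a) topology" where
  "composable G =
     subtopology (prod_topology (arrs G) (arrs G)) {(g, f). src G g = tgt G f}"

text \<open>Closure of the carriers under the structure maps is part of \<open>continuous_map\<close>.\<close>

locale topological_groupoid =
  fixes G :: "('x, 'a) groupoid"
  assumes src_cont: "continuous_map (arrs G) (objs G) (src G)"
    and tgt_cont: "continuous_map (arrs G) (objs G) (tgt G)"
    and unit_cont: "continuous_map (objs G) (arrs G) (gunit G)"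
    and comp_cont: "continuous_map (composable G) (arrs G) (\<lambda>(g, f). gcomp G g f)"
    and inv_cont: "continuous_map (arrs G) (arrs G) (ginv G)"
    and src_unit: "x \<in> Obj G \<Longrightarrow> src G (gunit G x) = x"
    and tgt_unit: "x \<in> Obj G \<Longrightarrow> tgt G (gunit G x) = x"
    and src_comp: "\<lbrakk>g \<in> Arr G; f \<in> Arr G; src G g = tgt G f\<rbrakk>
        \<Longrightarrow> src G (gcomp G g f) = src G f"
    and tgt_comp: "\<lbrakk>g \<in> Arr G; f \<in> Arr G; src G g = tgt G f\<rbrakk>
        \<Longrightarrow> tgt G (gcomp G g f) = tgt G g"
    and comp_assoc: "\<lbrakk>g \<in> Arr G; f \<in> Arr G; e \<in> Arr G;
          src G g = tgt G f; src G f = tgt G e\<rbrakk>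
        \<Longrightarrow> gcomp G (gcomp G g f) e = gcomp G g (gcomp G f e)"
    and comp_unit_left: "g \<in> Arr G \<Longrightarrow> gcomp G (gunit G (tgt G g)) g = g"
    and comp_unit_right: "g \<in> Arr G \<Longrightarrow> gcomp G g (gunit G (src G g)) = g"
    and src_inv: "g \<in> Arr G \<Longrightarrow> src G (ginv G g) = tgt G g"
    and tgt_inv: "g \<in> Arr G \<Longrightarrow> tgt G (ginv G g) = src G g"
    and comp_inv_right: "g \<in> Arr G \<Longrightarrow> gcomp G g (ginv G g) = gunit G (tgt G g)"
    and comp_inv_left: "g \<in> Arr G \<Longrightarrow> gcomp G (ginv G g) g = gunit G (src G g)"

definition units :: "('x, 'a) groupoid \<Rightarrow> 'a set" where
  "units G = gunit G ` Obj G"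

text \<open>A strict morphism is a continuous functor, with object map \<open>f0\<close> and arrow map \<open>f\<close>.\<close>

locale strict_morphism =
  fixes G :: "('x, 'a) groupoid" and G' :: "('y, 'b) groupoid"
    and f0 :: "'x \<Rightarrow> 'y" and f :: "'a \<Rightarrow> 'b"
  assumes obj_cont: "continuous_map (objs G) (objs G') f0"
    and arr_cont: "continuous_map (arrs G) (arrs G') f"
    and map_src: "g \<in> Arr G \<Longrightarrow> src G' (f g) = f0 (src G g)"
    and map_tgt: "g \<in> Arr G \<Longrightarrow> tgt G' (f g) = f0 (tgt G g)"
    and map_unit: "x \<in> Obj G \<Longrightarrow> f (gunit G x) = gunit G' (f0 x)"
    and map_comp: "\<lbrakk>g \<in> Arr G; h \<in> Arr G; src G g = tgt G h\<rbrakk>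
        \<Longrightarrow> f (gcomp G g h) = gcomp G' (f g) (f h)"

locale group_bundle = topological_groupoid H for H :: "('x, 'h) groupoid" +
  assumes src_eq_tgt: "h \<in> Arr H \<Longrightarrow> src H h = tgt H h"

definition fibre :: "('x, 'h) groupoid \<Rightarrow> 'x \<Rightarrow> 'h set" where
  "fibre H x = {h \<in> Arr H. src H h = x}"


section \<open>Crossed modules\<close>

text \<open>\<open>act h g\<close> stands for \<open>h\<^sup>g\<close>; it is meaningful only if \<open>h\<close> lies in the fibre over the
  target of \<open>g\<close>.\<close>

locale automorphism_action =
  fixes G :: "('x, 'g) groupoid" and H :: "('x, 'h) groupoid"
    and act :: "'h \<Rightarrow> 'g \<Rightarrow> 'h"
  assumes act_homeo: "g \<in> Arr G \<Longrightarrow>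
        homeomorphic_map (subtopology (arrs H) (fibre H (tgt G g)))
                         (subtopology (arrs H) (fibre H (src G g))) (\<lambda>h. act h g)"
    and act_mult: "\<lbrakk>g \<in> Arr G; h \<in> fibre H (tgt G g); k \<in> fibre H (tgt G g)\<rbrakk>
        \<Longrightarrow> act (gcomp H h k) g = gcomp H (act h g) (act k g)"
    and act_cont: "continuous_map
        (subtopology (prod_topology (arrs H) (arrs G)) {(h, g). h \<in> fibre H (tgt G g)})
        (arrs H) (\<lambda>(h, g). act h g)"
    and act_comp: "\<lbrakk>g \<in> Arr G; f \<in> Arr G; src G g = tgt G f; h \<in> fibre H (tgt G g)\<rbrakk>
        \<Longrightarrow> act h (gcomp G g f) = act (act h g) f"
    and act_unit: "\<lbrakk>x \<in> Obj G; h \<in> fibre H x\<rbrakk> \<Longrightarrow> act h (gunit G x) = h"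

record ('x, 'h, 'g) crossed_module =
  bun :: "('x, 'h) groupoid"
  gpd :: "('x, 'g) groupoid"
  bd :: "'h \<Rightarrow> 'g"
  act :: "'h \<Rightarrow> 'g \<Rightarrow> 'h"

locale groupoid_crossed_module =
  fixes C :: "('x, 'h, 'g) crossed_module"
  assumes gpd: "topological_groupoid (gpd C)"
    and bun: "group_bundle (bun C)"
    and same_objs: "objs (bun C) = objs (gpd C)"
    and bd: "strict_morphism (bun C) (gpd C) (\<lambda>x. x) (bd C)"
    and action: "automorphism_action (gpd C) (bun C) (act C)"
    and equivariance: "\<lbrakk>g \<in> Arr (gpd C); h \<in> fibre (bun C) (tgt (gpd C) g)\<rbrakk>
        \<Longrightarrow> bd C (act C h g) =
            gcomp (gpd C) (gcomp (gpd C) (ginv (gpd C) g) (bd C h)) g"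
    and peiffer: "\<lbrakk>x \<in> Obj (gpd C); h \<in> fibre (bun C) x; k \<in> fibre (bun C) x\<rbrakk>
        \<Longrightarrow> act C k (bd C h) =
            gcomp (bun C) (gcomp (bun C) (ginv (bun C) h) k) h"

text \<open>
  The two components of a strict morphism induce the same map of unit spaces, because the
  boundary maps are the identity on units; hence the single field \<open>map0\<close>.
\<close>

record ('x1, 'h1, 'g1, 'x2, 'h2, 'g2) cm_map =
  map0 :: "'x1 \<Rightarrow> 'x2"
  mapH :: "'h1 \<Rightarrow> 'h2"
  mapG :: "'g1 \<Rightarrow> 'g2"

locale strict_cm_morphism =
  fixes C1 :: "('x1, 'h1, 'g1) crossed_module" and C2 :: "('x2, 'h2, 'g2) crossed_module"
    and \<phi> :: "('x1, 'h1, 'g1, 'x2, 'h2, 'g2) cm_map"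
  assumes mapH: "strict_morphism (bun C1) (bun C2) (map0 \<phi>) (mapH \<phi>)"
    and mapG: "strict_morphism (gpd C1) (gpd C2) (map0 \<phi>) (mapG \<phi>)"
    and map_bd: "h \<in> Arr (bun C1) \<Longrightarrow> mapG \<phi> (bd C1 h) = bd C2 (mapH \<phi> h)"
    and map_act: "\<lbrakk>g \<in> Arr (gpd C1); h \<in> fibre (bun C1) (tgt (gpd C1) g)\<rbrakk>
        \<Longrightarrow> mapH \<phi> (act C1 h g) = act C2 (mapH \<phi> h) (mapG \<phi> g)"


section \<open>Pullbacks\<close>

definition pullback_groupoid ::
  "('x, 'g) groupoid \<Rightarrow> 'z topology \<Rightarrow> ('z \<Rightarrow> 'x) \<Rightarrow> ('z, 'z \<times> 'g \<times> 'z) groupoid" where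
  "pullback_groupoid G Z \<sigma> =
     \<lparr> objs = Z,
       arrs = subtopology (prod_topology Z (prod_topology (arrs G) Z))
                {(z1, g, z2). \<sigma> z1 = tgt G g \<and> src G g = \<sigma> z2},
       src = (\<lambda>(z1, g, z2). z2),
       tgt = (\<lambda>(z1, g, z2). z1),
       gunit = (\<lambda>z. (z, gunit G (\<sigma> z), z)),
       gcomp = (\<lambda>(z1, g, z2) (z2', f, z3). (z1, gcomp G g f, z3)),
       ginv = (\<lambda>(z1, g, z2). (z2, ginv G g, z1)) \<rparr>"

definition pullback_bundle ::
  "('x, 'h) groupoid \<Rightarrow> 'z topology \<Rightarrow> ('z \<Rightarrow> 'x) \<Rightarrow> ('z, 'z \<times> 'h) groupoid" where
  "pullback_bundle H Z \<sigma> =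
     \<lparr> objs = Z,
       arrs = subtopology (prod_topology Z (arrs H)) {(z, h). h \<in> fibre H (\<sigma> z)},
       src = fst,
       tgt = fst,
       gunit = (\<lambda>z. (z, gunit H (\<sigma> z))),
       gcomp = (\<lambda>(z, h) (z', k). (z, gcomp H h k)),
       ginv = (\<lambda>(z, h). (z, ginv H h)) \<rparr>"

definition pullback_cm ::
  "('x, 'h, 'g) crossed_module \<Rightarrow> 'z topology \<Rightarrow> ('z \<Rightarrow> 'x)
     \<Rightarrow> ('z, 'z \<times> 'h, 'z \<times> 'g \<times> 'z) crossed_module" where
  "pullback_cm C Z \<sigma> =
     \<lparr> bun = pullback_bundle (bun C) Z \<sigma>,
       gpd = pullback_groupoid (gpd C) Z \<sigma>,
       bd = (\<lambda>(z, h). (z, bd C h, z)),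
       act = (\<lambda>(z, h) (z1, g, z2). (z2, act C h g)) \<rparr>"


section \<open>Crossings\<close>

locale groupoid_extension =
  fixes K :: "('x, 'k) groupoid" and M :: "('x, 'm) groupoid" and G :: "('x, 'g) groupoid"
    and i :: "'k \<Rightarrow> 'm" and p :: "'m \<Rightarrow> 'g"
  assumes embedding: "embedding_map (arrs K) (arrs M) i"
    and surj: "p ` Arr M = Arr G"
    and exact: "i ` Arr K = {m \<in> Arr M. p m \<in> units G}"

text \<open>
  The groupoid \<open>\<M>\<close> together with the maps \<open>X\<^sub>1 \<leftarrow> \<M>\<^sup>0 \<rightarrow> X\<^sub>2\<close>, which are part
  of the data of a crossing.
\<close>

record ('y, 'm, 'x1, 'h1, 'g1, 'x2, 'h2, 'g2) crossing_data =
  mid :: "('y, 'm) groupoid"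
  tau :: "'y \<Rightarrow> 'x1"
  sigma :: "'y \<Rightarrow> 'x2"
  alpha1 :: "'y \<times> 'h1 \<Rightarrow> 'm"
  alpha2 :: "'m \<Rightarrow> 'y \<times> 'g1 \<times> 'y"
  beta1 :: "'y \<times> 'h2 \<Rightarrow> 'm"
  beta2 :: "'m \<Rightarrow> 'y \<times> 'g2 \<times> 'y"

abbreviation left_pullback where
  "left_pullback C1 K \<equiv> pullback_cm C1 (objs (mid K)) (tau K)"

abbreviation right_pullback where
  "right_pullback C2 K \<equiv> pullback_cm C2 (objs (mid K)) (sigma K)"

locale crossing =
  fixes C1 :: "('x1, 'h1, 'g1) crossed_module" and C2 :: "('x2, 'h2, 'g2) crossed_module"
    and K :: "('y, 'm, 'x1, 'h1, 'g1, 'x2, 'h2, 'g2) crossing_data"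
  assumes mid: "topological_groupoid (mid K)"
    and tau: "continuous_map (objs (mid K)) (objs (gpd C1)) (tau K)"
    and sigma: "continuous_map (objs (mid K)) (objs (gpd C2)) (sigma K)"
    and alpha1: "strict_morphism (bun (left_pullback C1 K)) (mid K) (\<lambda>y. y) (alpha1 K)"
    and alpha2: "strict_morphism (mid K) (gpd (left_pullback C1 K)) (\<lambda>y. y) (alpha2 K)"
    and beta1: "strict_morphism (bun (right_pullback C2 K)) (mid K) (\<lambda>y. y) (beta1 K)"
    and beta2: "strict_morphism (mid K) (gpd (right_pullback C2 K)) (\<lambda>y. y) (beta2 K)"
    and alpha2_alpha1: "h \<in> Arr (bun (left_pullback C1 K))
        \<Longrightarrow> alpha2 K (alpha1 K h) = bd (left_pullback C1 K) h"
    and beta2_beta1: "k \<in> Arr (bun (right_pullback C2 K))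
        \<Longrightarrow> beta2 K (beta1 K k) = bd (right_pullback C2 K) k"
    and beta2_alpha1: "h \<in> Arr (bun (left_pullback C1 K))
        \<Longrightarrow> beta2 K (alpha1 K h) \<in> units (gpd (right_pullback C2 K))"
    and alpha2_beta1: "k \<in> Arr (bun (right_pullback C2 K))
        \<Longrightarrow> alpha2 K (beta1 K k) \<in> units (gpd (left_pullback C1 K))"
    and extension: "groupoid_extension (bun (right_pullback C2 K)) (mid K)
        (gpd (left_pullback C1 K)) (beta1 K) (alpha2 K)"
    and alpha1_act: "\<lbrakk>m \<in> Arr (mid K);
          h \<in> fibre (bun (left_pullback C1 K)) (tgt (mid K) m)\<rbrakk>
        \<Longrightarrow> alpha1 K (act (left_pullback C1 K) h (alpha2 K m)) =
            gcomp (mid K) (gcomp (mid K) (ginv (mid K) m) (alpha1 K h)) m"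
    and beta1_act: "\<lbrakk>m \<in> Arr (mid K);
          k \<in> fibre (bun (right_pullback C2 K)) (tgt (mid K) m)\<rbrakk>
        \<Longrightarrow> beta1 K (act (right_pullback C2 K) k (beta2 K m)) =
            gcomp (mid K) (gcomp (mid K) (ginv (mid K) m) (beta1 K k)) m"


section \<open>The crossing induced by a strict morphism\<close>

text \<open>
  The semidirect product groupoid over \<open>X\<^sub>1\<close>: an arrow is a pair \<open>(g, h)\<close> of an arrow \<open>g\<close>
  of \<open>\<G>\<^sub>1\<close> and an \<open>h\<close> in the fibre of \<open>\<H>\<^sub>2\<close> over \<open>\<phi>(s(g))\<close>, to be thought of as the formal
  product \<open>g h\<close>. The multiplication is forced by the rule \<open>h f = f k\<close> where \<open>k\<close> is the
  result of acting on \<open>h\<close> by \<open>\<phi>(f)\<close>.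
\<close>

definition semidirect_groupoid ::
  "('x1, 'h1, 'g1) crossed_module \<Rightarrow> ('x2, 'h2, 'g2) crossed_module
     \<Rightarrow> ('x1, 'h1, 'g1, 'x2, 'h2, 'g2) cm_map \<Rightarrow> ('x1, 'g1 \<times> 'h2) groupoid" where
  "semidirect_groupoid C1 C2 \<phi> =
     \<lparr> objs = objs (gpd C1),
       arrs = subtopology (prod_topology (arrs (gpd C1)) (arrs (bun C2)))
                {(g, h). h \<in> fibre (bun C2) (map0 \<phi> (src (gpd C1) g))},
       src = (\<lambda>(g, h). src (gpd C1) g),
       tgt = (\<lambda>(g, h). tgt (gpd C1) g),
       gunit = (\<lambda>x. (gunit (gpd C1) x, gunit (bun C2) (map0 \<phi> x))),
       gcomp = (\<lambda>(g, h) (f, k).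
         (gcomp (gpd C1) g f, gcomp (bun C2) (act C2 h (mapG \<phi> f)) k)),
       ginv = (\<lambda>(g, h).
         (ginv (gpd C1) g, act C2 (ginv (bun C2) h) (mapG \<phi> (ginv (gpd C1) g)))) \<rparr>"

text \<open>
  The unit space is \<open>X\<^sub>1\<close>, mapped to \<open>X\<^sub>1\<close> by the identity and to \<open>X\<^sub>2\<close> by \<open>\<phi>\<close>. The
  construction is spelled out because the mere existence of a crossing is trivial:
  \<open>tau\<close> and \<open>sigma\<close> need not be surjective, so the empty groupoid is a crossing
  between any two crossed modules.
\<close>

definition induced_crossing ::
  "('x1, 'h1, 'g1) crossed_module \<Rightarrow> ('x2, 'h2, 'g2) crossed_module
     \<Rightarrow> ('x1, 'h1, 'g1, 'x2, 'h2, 'g2) cm_map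
     \<Rightarrow> ('x1, 'g1 \<times> 'h2, 'x1, 'h1, 'g1, 'x2, 'h2, 'g2) crossing_data" where
  "induced_crossing C1 C2 \<phi> =
     \<lparr> mid = semidirect_groupoid C1 C2 \<phi>,
       tau = (\<lambda>x. x),
       sigma = map0 \<phi>,
       alpha1 = (\<lambda>(x, h). (bd C1 h, ginv (bun C2) (mapH \<phi> h))),
       alpha2 = (\<lambda>(g, h). (tgt (gpd C1) g, g, src (gpd C1) g)),
       beta1 = (\<lambda>(x, h). (gunit (gpd C1) x, h)),
       beta2 = (\<lambda>(g, h).
         (tgt (gpd C1) g, gcomp (gpd C2) (mapG \<phi> g) (bd C2 h), src (gpd C1) g)) \<rparr>"

end

theory Submission
  imports Defs
begin

text \<open>
  The middle groupoid of the crossing is the semidirect product of \<open>\<G>\<^sub>1\<close> with the fibres of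
  \<open>\<H>\<^sub>2\<close>, where an arrow \<open>(g, h)\<close> stands for a formal product \<open>g h\<close>. Its groupoid laws
  hold because \<open>\<G>\<^sub>1\<close> acts on \<open>\<H>\<^sub>2\<close>, through \<open>\<phi>\<close>, by automorphisms. Its topology is that of a
  subspace of a product, so continuity of its operations follows by composing continuous maps.

  Projecting \<open>(g, h)\<close> to \<open>g\<close> and embedding \<open>h\<close> as \<open>(1, h)\<close> gives the extension
  \<open>\<H>\<^sub>2 \<rightarrow> \<M> \<rightarrow> \<G>\<^sub>1\<close>, as for any semidirect product. The embedding is a
  homeomorphism onto its image because \<open>(g, h) \<mapsto> (s(g), h)\<close> is a continuous left inverse
  defined on all of \<open>\<M>\<close>. The other two maps realise the formal product:
  \<open>\<beta>\<^sub>2(g, h) = \<phi>(g) \<partial>\<^sub>2(h)\<close>, and \<open>\<alpha>\<^sub>1(h) = (\<partial>\<^sub>1(h), \<phi>(h)\<inverse>)\<close>, which \<open>\<beta>\<^sub>2\<close> sends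
  to \<open>\<phi>(\<partial>\<^sub>1(h)) \<partial>\<^sub>2(\<phi>(h))\<inverse>\<close>, a unit. The first is multiplicative by the
  equivariance of \<open>\<partial>\<^sub>2\<close>, the second by the Peiffer identity in \<open>\<H>\<^sub>2\<close>.

  The two conjugation identities are proved in the form \<open>m l = a m\<close>, in which the inverses of
  \<open>\<M>\<close> do not occur (\<open>eq_conjugateI\<close>). On the first components they become the equivariance
  of \<open>\<partial>\<^sub>1\<close> and a unit law; on the second components both follow from the Peiffer identity.
\<close>

section \<open>Topological groupoids\<close>

lemma continuous_map_in_topspace:
  "\<lbrakk>continuous_map X Y f; x \<in> topspace X\<rbrakk> \<Longrightarrow> f x \<in> topspace Y"
  by (auto simp: continuous_map_def)

context topological_groupoid
begin

lemma src_in [simp]: "g \<in> Arr G \<Longrightarrow> src G g \<in> Obj G"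
  using src_cont by (auto simp: continuous_map_def)

lemma tgt_in [simp]: "g \<in> Arr G \<Longrightarrow> tgt G g \<in> Obj G"
  using tgt_cont by (auto simp: continuous_map_def)

lemma unit_in [simp]: "x \<in> Obj G \<Longrightarrow> gunit G x \<in> Arr G"
  using unit_cont by (auto simp: continuous_map_def)

lemma inv_in [simp]: "g \<in> Arr G \<Longrightarrow> ginv G g \<in> Arr G"
  using inv_cont by (auto simp: continuous_map_def)

lemma comp_in [simp]:
  assumes "g \<in> Arr G" "f \<in> Arr G" "src G g = tgt G f"
  shows "gcomp G g f \<in> Arr G"
proof -
  have "(g, f) \<in> topspace (composable G)"
    using assms by (simp add: composable_def)
  with comp_cont show ?thesis
    by (auto simp: continuous_map_def Pi_iff)
qed

lemmas structure_simps [simp] =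
  src_unit tgt_unit src_comp tgt_comp comp_unit_left comp_unit_right src_inv tgt_inv
  comp_inv_right comp_inv_left

text \<open>
  The product is continuous on the space of composable pairs; in this form the condition of
  composability is a side condition, so that continuity of composite expressions can be derived
  by resolution.
\<close>

lemma continuous_map_gcomp:
  assumes "continuous_map X (arrs G) a" "continuous_map X (arrs G) b"
    and "\<And>x. x \<in> topspace X \<Longrightarrow> src G (a x) = tgt G (b x)"
  shows "continuous_map X (arrs G) (\<lambda>x. gcomp G (a x) (b x))"
proof -
  have "continuous_map X (composable G) (\<lambda>x. (a x, b x))"
    using assms by (auto simp: composable_def continuous_map_in_subtopology continuous_map_pairwise o_def)
  from continuous_map_compose [OF this comp_cont] show ?thesis
    by (simp add: o_def)
qed

lemma continuous_map_ginv:
  "continuous_map X (arrs G) a \<Longrightarrow> continuous_map X (arrs G) (\<lambda>x. ginv G (a x))"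
  using continuous_map_compose [OF _ inv_cont] by (fastforce simp: o_def)

lemma continuous_map_src:
  "continuous_map X (arrs G) a \<Longrightarrow> continuous_map X (objs G) (\<lambda>x. src G (a x))"
  using continuous_map_compose [OF _ src_cont] by (fastforce simp: o_def)

lemma continuous_map_tgt:
  "continuous_map X (arrs G) a \<Longrightarrow> continuous_map X (objs G) (\<lambda>x. tgt G (a x))"
  using continuous_map_compose [OF _ tgt_cont] by (fastforce simp: o_def)

lemma continuous_map_gunit:
  "continuous_map X (objs G) a \<Longrightarrow> continuous_map X (arrs G) (\<lambda>x. gunit G (a x))"
  using continuous_map_compose [OF _ unit_cont] by (fastforce simp: o_def)

lemma inv_comp_cancel:
  assumes "g \<in> Arr G" "f \<in> Arr G" "src G g = tgt G f"
  shows "gcomp G (ginv G g) (gcomp G g f) = f"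
  using assms by (simp add: comp_assoc [symmetric])

lemma comp_inv_cancel:
  assumes "g \<in> Arr G" "f \<in> Arr G" "tgt G g = tgt G f"
  shows "gcomp G g (gcomp G (ginv G g) f) = f"
  using assms by (simp add: comp_assoc [symmetric])

lemma comp_unit_right_at: "\<lbrakk>g \<in> Arr G; src G g = x\<rbrakk> \<Longrightarrow> gcomp G g (gunit G x) = g"
  by auto

lemma inv_eqI:
  assumes "g \<in> Arr G" "f \<in> Arr G" "src G g = tgt G f" "gcomp G g f = gunit G (tgt G g)"
  shows "ginv G g = f"
  using inv_comp_cancel [OF assms(1-3)] assms comp_unit_right [of "ginv G g"] by simp

lemma inv_comp:
  assumes "g \<in> Arr G" "f \<in> Arr G" "src G g = tgt G f"
  shows "ginv G (gcomp G g f) = gcomp G (ginv G f) (ginv G g)"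
  by (rule inv_eqI) (use assms in \<open>simp_all add: comp_assoc comp_inv_cancel\<close>)

lemma inv_unit: "x \<in> Obj G \<Longrightarrow> ginv G (gunit G x) = gunit G x"
  using comp_unit_left [of "gunit G x"] by (intro inv_eqI) simp_all

text \<open>
  Both conjugation axioms of a crossing have this conclusion. The last premise is easier to verify
  in a semidirect product, whose inversion involves the action.
\<close>

lemma eq_conjugateI:
  assumes "m \<in> Arr G" "l \<in> Arr G" "a \<in> Arr G"
    and "tgt G l = src G m" "src G a = tgt G m" "tgt G a = tgt G m"
    and "gcomp G m l = gcomp G a m"
  shows "l = gcomp G (gcomp G (ginv G m) a) m"
  using inv_comp_cancel [of m l] assms by (simp add: comp_assoc)

end

context strict_morphism
begin

lemmas map_simps [simp] = map_src map_tgt map_unit map_comp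

lemma map_in [simp]: "g \<in> Arr G \<Longrightarrow> f g \<in> Arr G'"
  using arr_cont by (auto simp: continuous_map_def)

lemma map_obj_in [simp]: "x \<in> Obj G \<Longrightarrow> f0 x \<in> Obj G'"
  using obj_cont by (auto simp: continuous_map_def)

lemma continuous_map_arr:
  "continuous_map X (arrs G) a \<Longrightarrow> continuous_map X (arrs G') (\<lambda>x. f (a x))"
  using continuous_map_compose [OF _ arr_cont] by (fastforce simp: o_def)

text \<open>The image of the inverse is a right inverse of the image, and right inverses are unique.\<close>

lemma map_inv:
  assumes "topological_groupoid G" "topological_groupoid G'" "g \<in> Arr G"
  shows "f (ginv G g) = ginv G' (f g)"
proof -
  interpret G: topological_groupoid G by fact
  interpret G': topological_groupoid G' by fact
  show ?thesis
    by (rule sym, rule G'.inv_eqI)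
      (use assms(3) in \<open>simp_all add: map_comp [symmetric] del: map_comp\<close>)
qed

end

context group_bundle
begin

text \<open>Oriented this way, simplification expresses all conditions on fibres by sources.\<close>

lemma tgt_eq_src [simp]: "h \<in> Arr H \<Longrightarrow> tgt H h = src H h"
  by (simp add: src_eq_tgt)

end


section \<open>Crossed modules\<close>

context groupoid_crossed_module
begin

declare same_objs [simp]

sublocale G: topological_groupoid "gpd C" by (rule gpd)
sublocale H: group_bundle "bun C" by (rule bun)
sublocale B: strict_morphism "bun C" "gpd C" "\<lambda>x. x" "bd C" by (rule bd)
sublocale A: automorphism_action "gpd C" "bun C" "act C" by (rule action)

text \<open>
  The identification of the two unit spaces rewrites goals to the objects of the groupoid, where
  the corresponding facts about the bundle would no longer match.
\<close>

lemma bundle_obj_in [simp]: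
  "h \<in> Arr (bun C) \<Longrightarrow> src (bun C) h \<in> Obj (gpd C)"
  "x \<in> Obj (gpd C) \<Longrightarrow> gunit (bun C) x \<in> Arr (bun C)"
  using H.src_in H.unit_in by auto

lemma bd_inv:
  "h \<in> Arr (bun C) \<Longrightarrow> bd C (ginv (bun C) h) = ginv (gpd C) (bd C h)"
  using B.map_inv gpd H.topological_groupoid_axioms by blast

lemma act_in_fibre:
  assumes "g \<in> Arr (gpd C)" "h \<in> Arr (bun C)" "src (bun C) h = tgt (gpd C) g"
  shows "act C h g \<in> fibre (bun C) (src (gpd C) g)"
proof -
  have "(\<lambda>h. act C h g) ` topspace (subtopology (arrs (bun C)) (fibre (bun C) (tgt (gpd C) g)))
      = topspace (subtopology (arrs (bun C)) (fibre (bun C) (src (gpd C) g)))"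
    by (rule homeomorphic_imp_surjective_map) (rule A.act_homeo [OF assms(1)])
  then show ?thesis
    using assms by (auto simp: fibre_def)
qed

lemma act_in [simp]:
  assumes "g \<in> Arr (gpd C)" "h \<in> Arr (bun C)" "src (bun C) h = tgt (gpd C) g"
  shows "act C h g \<in> Arr (bun C)" "src (bun C) (act C h g) = src (gpd C) g"
  using act_in_fibre [OF assms] by (simp_all add: fibre_def)

lemma act_gcomp:
  assumes "g \<in> Arr (gpd C)" "h \<in> Arr (bun C)" "k \<in> Arr (bun C)"
    and "src (bun C) h = tgt (gpd C) g" "src (bun C) k = tgt (gpd C) g"
  shows "act C (gcomp (bun C) h k) g = gcomp (bun C) (act C h g) (act C k g)"
  using assms by (intro A.act_mult) (simp_all add: fibre_def)

lemma act_gunit: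
  assumes "g \<in> Arr (gpd C)"
  shows "act C (gunit (bun C) (tgt (gpd C) g)) g = gunit (bun C) (src (gpd C) g)"
proof -
  let ?u = "gunit (bun C) (tgt (gpd C) g)"
  let ?e = "act C ?u g"
  have u: "?u \<in> Arr (bun C)" "src (bun C) ?u = tgt (gpd C) g"
    using assms by simp_all
  have e: "?e \<in> Arr (bun C)" "src (bun C) ?e = src (gpd C) g"
    using assms u by simp_all
  \<comment> \<open>An idempotent of a group is its unit.\<close>
  have "gcomp (bun C) ?e ?e = ?e"
    using act_gcomp [OF assms u(1) u(1)] H.comp_unit_right [OF u(1)] u by simp
  with e show ?thesis
    using H.inv_comp_cancel [of ?e ?e] by simp
qed

lemma act_ginv:
  assumes "g \<in> Arr (gpd C)" "h \<in> Arr (bun C)" "src (bun C) h = tgt (gpd C) g"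
  shows "act C (ginv (bun C) h) g = ginv (bun C) (act C h g)"
  using assms act_gcomp [of g h "ginv (bun C) h"] act_gunit [of g]
  by (intro H.inv_eqI [symmetric]) simp_all

lemma act_trans:
  assumes "g \<in> Arr (gpd C)" "f \<in> Arr (gpd C)" "src (gpd C) g = tgt (gpd C) f"
    and "h \<in> Arr (bun C)" "src (bun C) h = tgt (gpd C) g"
  shows "act C (act C h g) f = act C h (gcomp (gpd C) g f)"
  using assms by (intro A.act_comp [symmetric]) (simp_all add: fibre_def)

lemma act_id [simp]:
  assumes "h \<in> Arr (bun C)" "src (bun C) h = x"
  shows "act C h (gunit (gpd C) x) = h"
  using assms by (intro A.act_unit) (auto simp: fibre_def)

text \<open>The Peiffer identity, bracketed to the right as the associativity rewriting produces it.\<close>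

lemma act_bd:
  assumes "h \<in> Arr (bun C)" "k \<in> Arr (bun C)" "src (bun C) k = src (bun C) h"
  shows "act C k (bd C h) = gcomp (bun C) (ginv (bun C) h) (gcomp (bun C) k h)"
  using assms peiffer [of "src (bun C) h" h k] by (simp add: fibre_def H.comp_assoc)

text \<open>
  Equivariance of the boundary without inverses: \<open>\<partial>(h)\<close> can be moved across \<open>g\<close> at the cost of
  letting \<open>g\<close> act on \<open>h\<close>.
\<close>

lemma comp_bd_act:
  assumes "g \<in> Arr (gpd C)" "h \<in> Arr (bun C)" "src (bun C) h = tgt (gpd C) g"
  shows "gcomp (gpd C) g (bd C (act C h g)) = gcomp (gpd C) (bd C h) g"
  using assms equivariance [of g h] by (simp add: fibre_def G.comp_assoc G.comp_inv_cancel)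

lemma continuous_map_act:
  assumes "continuous_map X (arrs (bun C)) a" "continuous_map X (arrs (gpd C)) b"
    and "\<And>x. x \<in> topspace X \<Longrightarrow> src (bun C) (a x) = tgt (gpd C) (b x)"
  shows "continuous_map X (arrs (bun C)) (\<lambda>x. act C (a x) (b x))"
proof -
  have "continuous_map X (subtopology (prod_topology (arrs (bun C)) (arrs (gpd C)))
      {(h, g). h \<in> fibre (bun C) (tgt (gpd C) g)}) (\<lambda>x. (a x, b x))"
    using assms by (auto simp: continuous_map_in_subtopology continuous_map_pairwise o_def
        fibre_def continuous_map_in_topspace)
  from continuous_map_compose [OF this A.act_cont] show ?thesis
    by (simp add: o_def)
qed

end


section \<open>The semidirect product groupoid of a strict morphism\<close>

locale cm_morphism =
  C1: groupoid_crossed_module C1 + C2: groupoid_crossed_module C2 + strict_cm_morphism C1 C2 \<phi>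
  for C1 :: "('x1, 'h1, 'g1) crossed_module"
    and C2 :: "('x2, 'h2, 'g2) crossed_module"
    and \<phi> :: "('x1, 'h1, 'g1, 'x2, 'h2, 'g2) cm_map"
begin

sublocale FH: strict_morphism "bun C1" "bun C2" "map0 \<phi>" "mapH \<phi>" by (rule mapH)
sublocale FG: strict_morphism "gpd C1" "gpd C2" "map0 \<phi>" "mapG \<phi>" by (rule mapG)

abbreviation M where "M \<equiv> semidirect_groupoid C1 C2 \<phi>"

lemma M_simps [simp]:
  "objs M = objs (gpd C1)"
  "src M (g, h) = src (gpd C1) g"
  "tgt M (g, h) = tgt (gpd C1) g"
  "gunit M x = (gunit (gpd C1) x, gunit (bun C2) (map0 \<phi> x))"
  "gcomp M (g, h) (f, k) =
     (gcomp (gpd C1) g f, gcomp (bun C2) (act C2 h (mapG \<phi> f)) k)"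
  "ginv M (g, h) =
     (ginv (gpd C1) g, act C2 (ginv (bun C2) h) (mapG \<phi> (ginv (gpd C1) g)))"
  by (simp_all add: semidirect_groupoid_def)

lemma Arr_M_iff [simp]:
  "(g, h) \<in> Arr M \<longleftrightarrow>
     g \<in> Arr (gpd C1) \<and> h \<in> Arr (bun C2) \<and> src (bun C2) h = map0 \<phi> (src (gpd C1) g)"
  by (auto simp: semidirect_groupoid_def fibre_def)

lemma continuous_map_into_M:
  assumes "continuous_map X (arrs (gpd C1)) a" "continuous_map X (arrs (bun C2)) b"
    and "\<And>x. x \<in> topspace X \<Longrightarrow> src (bun C2) (b x) = map0 \<phi> (src (gpd C1) (a x))"
  shows "continuous_map X (arrs M) (\<lambda>x. (a x, b x))"
  using assms
  by (auto simp: semidirect_groupoid_def continuous_map_in_subtopology continuous_map_pairwise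
      fibre_def o_def continuous_map_in_topspace)

lemma continuous_map_from_M [simp]:
  "continuous_map (arrs M) (arrs (gpd C1)) fst"
  "continuous_map (arrs M) (arrs (bun C2)) snd"
  by (simp_all add: semidirect_groupoid_def continuous_map_from_subtopology
      continuous_map_fst continuous_map_snd)

text \<open>
  Associativity combines the two laws of an action by automorphisms: with third factor \<open>l\<close>, the
  twist by \<open>l\<close> distributes over a product in \<open>\<H>\<^sub>2\<close>, and successive twists compose. The left unit
  law holds since automorphisms preserve units. The formula for inverses gives a right inverse since
  they preserve inverses, and a left one since acting by \<open>\<phi>(g)\<inverse>\<close> and then by \<open>\<phi>(g)\<close> is trivial.
\<close>

lemma topological_groupoid_M: "topological_groupoid M"
proof
  show "continuous_map (arrs M) (objs M) (src M)"
    using C1.G.continuous_map_src [OF continuous_map_from_M(1)]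
    by (simp add: semidirect_groupoid_def case_prod_unfold)
  show "continuous_map (arrs M) (objs M) (tgt M)"
    using C1.G.continuous_map_tgt [OF continuous_map_from_M(1)]
    by (simp add: semidirect_groupoid_def case_prod_unfold)
  have "gunit M = (\<lambda>x. (gunit (gpd C1) x, gunit (bun C2) (map0 \<phi> x)))"
    by (simp add: fun_eq_iff)
  then show "continuous_map (objs M) (arrs M) (gunit M)"
    using C1.G.unit_cont C2.H.continuous_map_gunit [of "objs (gpd C1)" "map0 \<phi>"] FG.obj_cont
    by (simp add: continuous_map_into_M)
  show "continuous_map (composable M) (arrs M) (\<lambda>(g, f). gcomp M g f)"
  proof -
    have m: "continuous_map (composable M) (arrs M) fst"
      and n: "continuous_map (composable M) (arrs M) snd"
      by (simp_all add: composable_def continuous_map_from_subtopology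
        continuous_map_fst continuous_map_snd)
    note cont = m [THEN continuous_map_compose, OF continuous_map_from_M(1), unfolded o_def]
      m [THEN continuous_map_compose, OF continuous_map_from_M(2), unfolded o_def]
      n [THEN continuous_map_compose, OF continuous_map_from_M(1), unfolded o_def]
      n [THEN continuous_map_compose, OF continuous_map_from_M(2), unfolded o_def]
    have "continuous_map (composable M) (arrs M)
        (\<lambda>p. (gcomp (gpd C1) (fst (fst p)) (fst (snd p)),
              gcomp (bun C2) (act C2 (snd (fst p)) (mapG \<phi> (fst (snd p)))) (snd (snd p))))"
      by (intro continuous_map_into_M C1.G.continuous_map_gcomp C2.H.continuous_map_gcomp
          C2.continuous_map_act FG.continuous_map_arr cont)
        (auto simp: composable_def)
    then show ?thesis
      by (simp add: semidirect_groupoid_def case_prod_unfold)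
  qed
  have "continuous_map (arrs M) (arrs M)
      (\<lambda>p. (ginv (gpd C1) (fst p),
            act C2 (ginv (bun C2) (snd p)) (mapG \<phi> (ginv (gpd C1) (fst p)))))"
    by (intro continuous_map_into_M C1.G.continuous_map_ginv C2.H.continuous_map_ginv
        C2.continuous_map_act FG.continuous_map_arr continuous_map_from_M) auto
  then show "continuous_map (arrs M) (arrs M) (ginv M)"
    by (simp add: semidirect_groupoid_def case_prod_unfold)
next
  fix x assume "x \<in> Obj M"
  then show "src M (gunit M x) = x" "tgt M (gunit M x) = x" by simp_all
next
  fix m n assume "m \<in> Arr M" "n \<in> Arr M" "src M m = tgt M n"
  then show "src M (gcomp M m n) = src M n" "tgt M (gcomp M m n) = tgt M m"
    by (cases m; cases n; simp)+
next
  fix m n l assume "m \<in> Arr M" "n \<in> Arr M" "l \<in> Arr M" "src M m = tgt M n" "src M n = tgt M l"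
  then show "gcomp M (gcomp M m n) l = gcomp M m (gcomp M n l)"
    by (cases m; cases n; cases l)
      (simp add: C1.G.comp_assoc C2.H.comp_assoc C2.act_gcomp C2.act_trans)
next
  fix m assume "m \<in> Arr M"
  then obtain g h where m: "m = (g, h)" and gh: "g \<in> Arr (gpd C1)" "h \<in> Arr (bun C2)"
    "src (bun C2) h = map0 \<phi> (src (gpd C1) g)"
    by (cases m) simp
  show "gcomp M (gunit M (tgt M m)) m = m"
    using gh C2.act_gunit [of "mapG \<phi> g"] C2.H.comp_unit_left [of h] by (simp add: m)
  show "gcomp M m (gunit M (src M m)) = m"
    using gh C2.H.comp_unit_right [of h] by (simp add: m)
  show "src M (ginv M m) = tgt M m" "tgt M (ginv M m) = src M m"
    using gh by (simp_all add: m)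
  show "gcomp M m (ginv M m) = gunit M (tgt M m)"
    using gh by (simp add: m C2.act_ginv)
  show "gcomp M (ginv M m) m = gunit M (src M m)"
    using gh by (simp add: m C2.act_trans FG.map_comp [symmetric] del: FG.map_comp)
qed

sublocale M: topological_groupoid M by (rule topological_groupoid_M)

end


section \<open>The induced crossing\<close>

lemma pullback_groupoid_simps [simp]:
  "objs (pullback_groupoid G Z \<sigma>) = Z"
  "src (pullback_groupoid G Z \<sigma>) (z1, g, z2) = z2"
  "tgt (pullback_groupoid G Z \<sigma>) (z1, g, z2) = z1"
  "gunit (pullback_groupoid G Z \<sigma>) z = (z, gunit G (\<sigma> z), z)"
  "gcomp (pullback_groupoid G Z \<sigma>) (z1, g, z2) (z2', f, z3) = (z1, gcomp G g f, z3)"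
  by (simp_all add: pullback_groupoid_def)

lemma Arr_pullback_groupoid_iff [simp]:
  "(z1, g, z2) \<in> Arr (pullback_groupoid G Z \<sigma>) \<longleftrightarrow>
     z1 \<in> topspace Z \<and> g \<in> Arr G \<and> z2 \<in> topspace Z \<and> \<sigma> z1 = tgt G g \<and> src G g = \<sigma> z2"
  by (auto simp: pullback_groupoid_def)

lemma continuous_map_into_pullback_groupoid:
  assumes "continuous_map X Z a" "continuous_map X (arrs G) g" "continuous_map X Z b"
    and "\<And>x. x \<in> topspace X \<Longrightarrow> \<sigma> (a x) = tgt G (g x)"
    and "\<And>x. x \<in> topspace X \<Longrightarrow> src G (g x) = \<sigma> (b x)"
  shows "continuous_map X (arrs (pullback_groupoid G Z \<sigma>)) (\<lambda>x. (a x, g x, b x))"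
  using assms
  by (auto simp: pullback_groupoid_def continuous_map_in_subtopology continuous_map_pairwise o_def)

lemma pullback_bundle_simps [simp]:
  "objs (pullback_bundle H Z \<sigma>) = Z"
  "src (pullback_bundle H Z \<sigma>) (z, h) = z"
  "tgt (pullback_bundle H Z \<sigma>) (z, h) = z"
  "gunit (pullback_bundle H Z \<sigma>) z = (z, gunit H (\<sigma> z))"
  "gcomp (pullback_bundle H Z \<sigma>) (z, h) (z', k) = (z, gcomp H h k)"
  by (simp_all add: pullback_bundle_def)

lemma Arr_pullback_bundle_iff [simp]:
  "(z, h) \<in> Arr (pullback_bundle H Z \<sigma>) \<longleftrightarrow> z \<in> topspace Z \<and> h \<in> Arr H \<and> src H h = \<sigma> z"
  by (auto simp: pullback_bundle_def fibre_def)

lemma continuous_map_from_pullback_bundle: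
  "continuous_map (arrs (pullback_bundle H Z \<sigma>)) Z fst"
  "continuous_map (arrs (pullback_bundle H Z \<sigma>)) (arrs H) snd"
  by (simp_all add: pullback_bundle_def continuous_map_from_subtopology
      continuous_map_fst continuous_map_snd)

lemma continuous_map_into_pullback_bundle:
  assumes "continuous_map X Z a" "continuous_map X (arrs H) b"
    and "\<And>x. x \<in> topspace X \<Longrightarrow> src H (b x) = \<sigma> (a x)"
  shows "continuous_map X (arrs (pullback_bundle H Z \<sigma>)) (\<lambda>x. (a x, b x))"
  using assms
  by (auto simp: pullback_bundle_def continuous_map_in_subtopology continuous_map_pairwise o_def
      fibre_def continuous_map_in_topspace)

lemma pullback_cm_simps [simp]:
  "bun (pullback_cm C Z \<sigma>) = pullback_bundle (bun C) Z \<sigma>"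
  "gpd (pullback_cm C Z \<sigma>) = pullback_groupoid (gpd C) Z \<sigma>"
  "bd (pullback_cm C Z \<sigma>) (z, h) = (z, bd C h, z)"
  "act (pullback_cm C Z \<sigma>) (z, h) (z1, g, z2) = (z2, act C h g)"
  by (simp_all add: pullback_cm_def)

context cm_morphism
begin

abbreviation K where "K \<equiv> induced_crossing C1 C2 \<phi>"

text \<open>The four pullbacks that occur in the crossing, along the identity and the object map.\<close>

abbreviation bundle1 where
  "bundle1 \<equiv> pullback_bundle (bun C1) (objs (gpd C1)) (\<lambda>x. x)"

abbreviation groupoid1 where
  "groupoid1 \<equiv> pullback_groupoid (gpd C1) (objs (gpd C1)) (\<lambda>x. x)"

abbreviation bundle2 where
  "bundle2 \<equiv> pullback_bundle (bun C2) (objs (gpd C1)) (map0 \<phi>)"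

abbreviation groupoid2 where
  "groupoid2 \<equiv> pullback_groupoid (gpd C2) (objs (gpd C1)) (map0 \<phi>)"

lemma K_simps [simp]:
  "mid K = M"
  "tau K = (\<lambda>x. x)"
  "sigma K = map0 \<phi>"
  "alpha1 K (x, h) = (bd C1 h, ginv (bun C2) (mapH \<phi> h))"
  "alpha2 K (g, k) = (tgt (gpd C1) g, g, src (gpd C1) g)"
  "beta1 K (x, k) = (gunit (gpd C1) x, k)"
  "beta2 K (g, k) =
     (tgt (gpd C1) g, gcomp (gpd C2) (mapG \<phi> g) (bd C2 k), src (gpd C1) g)"
  by (simp_all add: induced_crossing_def)

text \<open>
  Inversion reverses the order of \<open>\<phi>(h)\<close> and \<open>\<phi>(k)\<close>; the twist in the product of \<open>\<M>\<close> puts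
  it right. By the Peiffer identity \<open>\<phi>(h)\<inverse>\<close> acted on by \<open>\<phi>(\<partial>\<^sub>1(k)) = \<partial>\<^sub>2(\<phi>(k))\<close>
  is \<open>\<phi>(k)\<inverse> \<phi>(h)\<inverse> \<phi>(k)\<close>, and multiplying by \<open>\<phi>(k)\<inverse>\<close> leaves
  \<open>\<phi>(k)\<inverse> \<phi>(h)\<inverse> = \<phi>(h k)\<inverse>\<close>.
\<close>

lemma alpha1_morphism:
  "strict_morphism bundle1 M (\<lambda>x. x) (alpha1 K)"
proof (rule strict_morphism.intro)
  show "continuous_map (objs bundle1) (objs M) (\<lambda>x. x)"
    by simp
  have "continuous_map (arrs bundle1) (arrs M)
      (\<lambda>p. (bd C1 (snd p), ginv (bun C2) (mapH \<phi> (snd p))))"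
    by (intro continuous_map_into_M C1.B.continuous_map_arr C2.H.continuous_map_ginv
        FH.continuous_map_arr continuous_map_from_pullback_bundle) auto
  then show "continuous_map (arrs bundle1) (arrs M) (alpha1 K)"
    by (simp add: induced_crossing_def case_prod_unfold)
next
  fix p assume "p \<in> Arr bundle1"
  then show "src M (alpha1 K p) = src bundle1 p" "tgt M (alpha1 K p) = tgt bundle1 p"
    by (cases p; simp)+
next
  fix x assume "x \<in> Obj bundle1"
  then show "alpha1 K (gunit bundle1 x) = gunit M x"
    by (simp add: C2.H.inv_unit)
next
  fix p q assume "p \<in> Arr bundle1" "q \<in> Arr bundle1" "src bundle1 p = tgt bundle1 q"
  then show "alpha1 K (gcomp bundle1 p q) = gcomp M (alpha1 K p) (alpha1 K q)"
    by (cases p; cases q) (simp add: map_bd C2.act_bd C2.H.inv_comp C2.H.comp_assoc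
        C2.H.comp_unit_right_at)
qed

lemma alpha2_morphism:
  "strict_morphism M groupoid1 (\<lambda>x. x) (alpha2 K)"
proof (rule strict_morphism.intro)
  show "continuous_map (objs M) (objs groupoid1) (\<lambda>x. x)"
    by simp
  have "continuous_map (arrs M) (arrs groupoid1)
      (\<lambda>m. (tgt (gpd C1) (fst m), fst m, src (gpd C1) (fst m)))"
    by (intro continuous_map_into_pullback_groupoid C1.G.continuous_map_src
        C1.G.continuous_map_tgt continuous_map_from_M) auto
  then show "continuous_map (arrs M) (arrs groupoid1) (alpha2 K)"
    by (simp add: induced_crossing_def case_prod_unfold)
next
  fix m assume "m \<in> Arr M"
  then show "src groupoid1 (alpha2 K m) = src M m" "tgt groupoid1 (alpha2 K m) = tgt M m"
    by (cases m; simp)+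
next
  fix x assume "x \<in> Obj M"
  then show "alpha2 K (gunit M x) = gunit groupoid1 x"
    by simp
next
  fix m n assume "m \<in> Arr M" "n \<in> Arr M" "src M m = tgt M n"
  then show "alpha2 K (gcomp M m n) = gcomp groupoid1 (alpha2 K m) (alpha2 K n)"
    by (cases m; cases n) simp
qed

lemma beta1_morphism:
  "strict_morphism bundle2 M (\<lambda>x. x) (beta1 K)"
proof (rule strict_morphism.intro)
  show "continuous_map (objs bundle2) (objs M) (\<lambda>x. x)"
    by simp
  have "continuous_map (arrs bundle2) (arrs M) (\<lambda>p. (gunit (gpd C1) (fst p), snd p))"
    by (intro continuous_map_into_M C1.G.continuous_map_gunit
        continuous_map_from_pullback_bundle) auto
  then show "continuous_map (arrs bundle2) (arrs M) (beta1 K)"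
    by (simp add: induced_crossing_def case_prod_unfold)
next
  fix p assume "p \<in> Arr bundle2"
  then show "src M (beta1 K p) = src bundle2 p" "tgt M (beta1 K p) = tgt bundle2 p"
    by (cases p; simp)+
next
  fix x assume "x \<in> Obj bundle2"
  then show "beta1 K (gunit bundle2 x) = gunit M x"
    by simp
next
  fix p q assume "p \<in> Arr bundle2" "q \<in> Arr bundle2" "src bundle2 p = tgt bundle2 q"
  then show "beta1 K (gcomp bundle2 p q) = gcomp M (beta1 K p) (beta1 K q)"
    using C1.G.comp_unit_left [of "gunit (gpd C1) (fst p)"] by (cases p; cases q) simp
qed

text \<open>
  Equivariance of \<open>\<partial>\<^sub>2\<close> turns the twist in the product of \<open>\<M>\<close> into the exchange
  \<open>\<partial>\<^sub>2(h) \<phi>(f) = \<phi>(f) \<partial>\<^sub>2(h')\<close>, where \<open>h'\<close> is the result of acting on \<open>h\<close> by \<open>\<phi>(f)\<close>.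
\<close>

lemma beta2_morphism:
  "strict_morphism M groupoid2 (\<lambda>x. x) (beta2 K)"
proof (rule strict_morphism.intro)
  show "continuous_map (objs M) (objs groupoid2) (\<lambda>x. x)"
    by simp
  have "continuous_map (arrs M) (arrs groupoid2)
      (\<lambda>m. (tgt (gpd C1) (fst m), gcomp (gpd C2) (mapG \<phi> (fst m)) (bd C2 (snd m)),
            src (gpd C1) (fst m)))"
    by (intro continuous_map_into_pullback_groupoid C1.G.continuous_map_src
        C1.G.continuous_map_tgt C2.G.continuous_map_gcomp FG.continuous_map_arr
        C2.B.continuous_map_arr continuous_map_from_M) auto
  then show "continuous_map (arrs M) (arrs groupoid2) (beta2 K)"
    by (simp add: induced_crossing_def case_prod_unfold)
next
  fix m assume "m \<in> Arr M"
  then show "src groupoid2 (beta2 K m) = src M m" "tgt groupoid2 (beta2 K m) = tgt M m"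
    by (cases m; simp)+
next
  fix x assume "x \<in> Obj M"
  then show "beta2 K (gunit M x) = gunit groupoid2 x"
    using C2.G.comp_unit_left [of "gunit (gpd C2) (map0 \<phi> x)"] by simp
next
  fix m n assume "m \<in> Arr M" "n \<in> Arr M" "src M m = tgt M n"
  then obtain g h f k where mn: "m = (g, h)" "n = (f, k)"
    and gf: "g \<in> Arr (gpd C1)" "f \<in> Arr (gpd C1)" "src (gpd C1) g = tgt (gpd C1) f"
    and hk: "h \<in> Arr (bun C2)" "src (bun C2) h = map0 \<phi> (src (gpd C1) g)"
      "k \<in> Arr (bun C2)" "src (bun C2) k = map0 \<phi> (src (gpd C1) f)"
    by (cases m; cases n) simp
  let ?b = "bd C2 (act C2 h (mapG \<phi> f))"
  have "gcomp (gpd C2) (mapG \<phi> f) (gcomp (gpd C2) ?b (bd C2 k))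
      = gcomp (gpd C2) (gcomp (gpd C2) (mapG \<phi> f) ?b) (bd C2 k)"
    using gf hk by (simp add: C2.G.comp_assoc)
  also have "\<dots> = gcomp (gpd C2) (bd C2 h) (gcomp (gpd C2) (mapG \<phi> f) (bd C2 k))"
    using gf hk by (simp add: C2.comp_bd_act C2.G.comp_assoc)
  finally show "beta2 K (gcomp M m n) = gcomp groupoid2 (beta2 K m) (beta2 K n)"
    using gf hk by (simp add: mn C2.G.comp_assoc)
qed

text \<open>
  Surjectivity comes from the section \<open>g \<mapsto> (g, 1)\<close>, and the embedding property from the
  continuous left inverse \<open>(g, h) \<mapsto> (s(g), h)\<close> of \<open>\<beta>\<^sub>1\<close>.
\<close>

lemma extension_beta1_alpha2:
  "groupoid_extension bundle2 M groupoid1 (beta1 K) (alpha2 K)"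
proof (rule groupoid_extension.intro)
  show "alpha2 K ` Arr M = Arr groupoid1"
  proof
    show "alpha2 K ` Arr M \<subseteq> Arr groupoid1"
      by auto
    show "Arr groupoid1 \<subseteq> alpha2 K ` Arr M"
    proof
      fix q assume "q \<in> Arr groupoid1"
      then obtain g where g: "g \<in> Arr (gpd C1)" "q = (tgt (gpd C1) g, g, src (gpd C1) g)"
        by (cases q) auto
      then show "q \<in> alpha2 K ` Arr M"
        using g by (intro image_eqI [of _ _ "(g, gunit (bun C2) (map0 \<phi> (src (gpd C1) g)))"])
          simp_all
    qed
  qed
  show "beta1 K ` Arr bundle2 = {m \<in> Arr M. alpha2 K m \<in> units groupoid1}"
  proof
    show "beta1 K ` Arr bundle2 \<subseteq> {m \<in> Arr M. alpha2 K m \<in> units groupoid1}"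
      by (auto simp: units_def)
    show "{m \<in> Arr M. alpha2 K m \<in> units groupoid1} \<subseteq> beta1 K ` Arr bundle2"
    proof
      fix m assume "m \<in> {m \<in> Arr M. alpha2 K m \<in> units groupoid1}"
      then obtain x k where "m = beta1 K (x, k)" "(x, k) \<in> Arr bundle2"
        by (cases m) (auto simp: units_def)
      then show "m \<in> beta1 K ` Arr bundle2"
        by blast
    qed
  qed
  have "continuous_map (arrs M) (arrs bundle2) (\<lambda>m. (src (gpd C1) (fst m), snd m))"
    by (intro continuous_map_into_pullback_bundle C1.G.continuous_map_src continuous_map_from_M)
      auto
  then have "retraction_maps (arrs M) (arrs bundle2) (\<lambda>m. (src (gpd C1) (fst m), snd m)) (beta1 K)"
    using strict_morphism.arr_cont [OF beta1_morphism] by (auto simp: retraction_maps_def)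
  then show "embedding_map (arrs bundle2) (arrs M) (beta1 K)"
    by (intro section_imp_embedding_map) (auto simp: section_map_def)
qed

text \<open>
  Let \<open>m = (g, k)\<close> and \<open>l = \<phi>(h')\<close>, where \<open>h'\<close> is the result of acting on \<open>h\<close> by \<open>g\<close>. The
  Peiffer identity gives the second component \<open>(l\<inverse> k l) l\<inverse> = l\<inverse> k\<close> on the left of
  \<open>m \<alpha>\<^sub>1(h') = \<alpha>\<^sub>1(h) m\<close>; on the right it is \<open>l\<inverse> k\<close> too, because \<open>\<phi>\<close> respects the actions.
\<close>

lemma alpha1_conjugation:
  assumes m: "m \<in> Arr M" and p: "p \<in> fibre bundle1 (tgt M m)"
  shows "alpha1 K (act (left_pullback C1 K) p (alpha2 K m))
    = gcomp M (gcomp M (ginv M m) (alpha1 K p)) m"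
proof (rule M.eq_conjugateI [OF m])
  obtain g k where gk: "m = (g, k)" "g \<in> Arr (gpd C1)" "k \<in> Arr (bun C2)"
      "src (bun C2) k = map0 \<phi> (src (gpd C1) g)"
    using m by (cases m) simp
  obtain h where h: "p = (tgt (gpd C1) g, h)" "h \<in> Arr (bun C1)"
      "src (bun C1) h = tgt (gpd C1) g"
    using p gk by (cases p) (auto simp: fibre_def)
  show "gcomp M m (alpha1 K (act (left_pullback C1 K) p (alpha2 K m)))
      = gcomp M (alpha1 K p) m"
    using gk h by (simp add: C1.comp_bd_act map_bd C2.act_bd C2.act_ginv map_act fibre_def
        C2.H.comp_assoc C2.H.comp_unit_right_at)
  show "alpha1 K p \<in> Arr M" "src M (alpha1 K p) = tgt M m" "tgt M (alpha1 K p) = tgt M m"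
    "alpha1 K (act (left_pullback C1 K) p (alpha2 K m)) \<in> Arr M"
    "tgt M (alpha1 K (act (left_pullback C1 K) p (alpha2 K m))) = src M m"
    using gk h by simp_all
qed

text \<open>
  Let \<open>m = (g, h)\<close>. Acting on \<open>k\<close> by \<open>\<beta>\<^sub>2(m) = \<phi>(g) \<partial>\<^sub>2(h)\<close> means acting by \<open>\<phi>(g)\<close> and then,
  by the Peiffer identity, conjugating by \<open>h\<close>; multiplication by \<open>h\<close> on the left undoes half
  of the conjugation.
\<close>

lemma beta1_conjugation:
  assumes m: "m \<in> Arr M" and q: "q \<in> fibre bundle2 (tgt M m)"
  shows "beta1 K (act (right_pullback C2 K) q (beta2 K m))
    = gcomp M (gcomp M (ginv M m) (beta1 K q)) m"
proof (rule M.eq_conjugateI [OF m])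
  obtain g h where gh: "m = (g, h)" "g \<in> Arr (gpd C1)" "h \<in> Arr (bun C2)"
      "src (bun C2) h = map0 \<phi> (src (gpd C1) g)"
    using m by (cases m) simp
  obtain k where k: "q = (tgt (gpd C1) g, k)" "k \<in> Arr (bun C2)"
      "src (bun C2) k = map0 \<phi> (tgt (gpd C1) g)"
    using q gh by (cases q) (auto simp: fibre_def)
  have "gcomp (bun C2) h (act C2 k (gcomp (gpd C2) (mapG \<phi> g) (bd C2 h)))
      = gcomp (bun C2) (act C2 k (mapG \<phi> g)) h"
    using gh k by (simp add: C2.act_trans [symmetric] C2.act_bd C2.H.comp_inv_cancel)
  then show "gcomp M m (beta1 K (act (right_pullback C2 K) q (beta2 K m)))
      = gcomp M (beta1 K q) m"
    using gh k by simp
  show "beta1 K q \<in> Arr M" "src M (beta1 K q) = tgt M m" "tgt M (beta1 K q) = tgt M m"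
    "beta1 K (act (right_pullback C2 K) q (beta2 K m)) \<in> Arr M"
    "tgt M (beta1 K (act (right_pullback C2 K) q (beta2 K m))) = src M m"
    using gh k by simp_all
qed

lemma crossing_induced_crossing: "crossing C1 C2 K"
proof (rule crossing.intro)
  show "topological_groupoid (mid K)"
    using topological_groupoid_M by simp
  show "continuous_map (objs (mid K)) (objs (gpd C1)) (tau K)"
    "continuous_map (objs (mid K)) (objs (gpd C2)) (sigma K)"
    using FG.obj_cont by simp_all
  show "strict_morphism (bun (left_pullback C1 K)) (mid K) (\<lambda>y. y) (alpha1 K)"
    using alpha1_morphism by simp
  show "strict_morphism (mid K) (gpd (left_pullback C1 K)) (\<lambda>y. y) (alpha2 K)"
    using alpha2_morphism by simp
  show "strict_morphism (bun (right_pullback C2 K)) (mid K) (\<lambda>y. y) (beta1 K)"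
    using beta1_morphism by simp
  show "strict_morphism (mid K) (gpd (right_pullback C2 K)) (\<lambda>y. y) (beta2 K)"
    using beta2_morphism by simp
  show "groupoid_extension (bun (right_pullback C2 K)) (mid K)
      (gpd (left_pullback C1 K)) (beta1 K) (alpha2 K)"
    using extension_beta1_alpha2 by simp
next
  fix p assume "p \<in> Arr (bun (left_pullback C1 K))"
  then obtain h where h: "p = (src (bun C1) h, h)" "h \<in> Arr (bun C1)"
    by (cases p) auto
  then show "alpha2 K (alpha1 K p) = bd (left_pullback C1 K) p"
    by simp
  show "beta2 K (alpha1 K p) \<in> units (gpd (right_pullback C2 K))"
    using h by (auto simp: units_def map_bd C2.bd_inv)
next
  fix q assume "q \<in> Arr (bun (right_pullback C2 K))"
  then obtain x k where k: "q = (x, k)" "x \<in> Obj (gpd C1)" "k \<in> Arr (bun C2)"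
      "src (bun C2) k = map0 \<phi> x"
    by (cases q) auto
  then show "beta2 K (beta1 K q) = bd (right_pullback C2 K) q"
    using C2.G.comp_unit_left [of "bd C2 k"] by simp
  show "alpha2 K (beta1 K q) \<in> units (gpd (left_pullback C1 K))"
    using k by (auto simp: units_def)
next
  fix m p assume "m \<in> Arr (mid K)" "p \<in> fibre (bun (left_pullback C1 K)) (tgt (mid K) m)"
  then show "alpha1 K (act (left_pullback C1 K) p (alpha2 K m))
      = gcomp (mid K) (gcomp (mid K) (ginv (mid K) m) (alpha1 K p)) m"
    using alpha1_conjugation [of m p] by simp
next
  fix m q assume "m \<in> Arr (mid K)" "q \<in> fibre (bun (right_pullback C2 K)) (tgt (mid K) m)"
  then show "beta1 K (act (right_pullback C2 K) q (beta2 K m))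
      = gcomp (mid K) (gcomp (mid K) (ginv (mid K) m) (beta1 K q)) m"
    using beta1_conjugation [of m q] by simp
qed

end

theorem proposition4p11:
  fixes C1 :: "('x1, 'h1, 'g1) crossed_module" and C2 :: "('x2, 'h2, 'g2) crossed_module"
    and \<phi> :: "('x1, 'h1, 'g1, 'x2, 'h2, 'g2) cm_map"
  assumes "groupoid_crossed_module C1"
    and "groupoid_crossed_module C2"
    and "strict_cm_morphism C1 C2 \<phi>"
  shows "crossing C1 C2 (induced_crossing C1 C2 \<phi>)"
proof -
  interpret cm_morphism C1 C2 \<phi>
    using assms by (rule cm_morphism.intro)
  show ?thesis
    by (rule crossing_induced_crossing)
qed

end
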